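(* Let $\mathfrak A$ be any one of the complex Lie algebras $\mathfrak m_0(n)$, $\mathfrak m_2(n)$, $W^+(n)$, $\mathfrak m_{0,1}(2k+1)$, $\mathfrak m_{0,2}(2k+2)$, $\mathfrak m_{0,3}(2k+3)$, $\mathfrak g_{7,\alpha},\dots,\mathfrak g_{11,\alpha}$ listed in the context. Then $\mathfrak A$ has 2-local automorphisms which are not automorphisms; that is, there exists a 2-local automorphism $\Delta:\mathfrak A\to\mathfrak A$ that is not an automorphism of $\mathfrak A$.
   Context: A (not necessarily linear) map $\Delta:\mathfrak A\to\mathfrak A$ is a 2-local automorphism if for any $x,y\in\mathfrak A$ there exists a Lie algebra automorphism $\varphi_{x,y}$ of $\mathfrak A$ with $\Delta(x)=\varphi_{x,y}(x)$ and $\Delta(y)=\varphi_{x,y}(y)$. The algebras (over $\mathbb C$, basis $\{e_1,\dots,e_n\}$, $n$ the dimension; brackets not listed and not obtained by skew-symmetry are zero): $\mathfrak m_0(n)$, $n\ge3$: $[e_1,e_i]=e_{i+1}$, $2\le i\le n-1$. $\mathfrak m_2(n)$, $n\ge5$: $[e_1,e_i]=e_{i+1}$, $2\le i\le n-1$; $[e_2,e_i]=e_{i+2}$, $3\le i\le n-2$. $W^+(n)$, $n\ge12$: $[e_i,e_j]=(j-i)e_{i+j}$ if $i+j\le n$, and $0$ if $i+j>n$. $\mathfrak m_{0,1}(2k+1)$, $k\ge3$: $[e_1,e_i]=e_{i+1}$, $2\le i\le 2k$; $[e_l,e_{2k-l+1}]=(-1)^{l+1}e_{2k+1}$, $2\le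 l\le k$. $\mathfrak m_{0,2}(2k+2)$, $k\ge3$: $[e_1,e_i]=e_{i+1}$, $2\le i\le 2k+1$; $[e_l,e_{2k-l+1}]=(-1)^{l+1}e_{2k+1}$, $2\le l\le k$; $[e_j,e_{2k-j+2}]=(-1)^{j+1}(k-j+1)e_{2k+2}$, $2\le j\le k$. $\mathfrak m_{0,3}(2k+3)$, $k\ge3$: $[e_1,e_i]=e_{i+1}$, $2\le i\le 2k+2$; $[e_l,e_{2k-l+1}]=(-1)^{l+1}e_{2k+1}$, $2\le l\le k$; $[e_j,e_{2k-j+2}]=(-1)^{j+1}(k-j+1)e_{2k+2}$, $2\le j\le k$; $[e_m,e_{2k-m+3}]=(-1)^m\bigl((m-2)k-\frac{(m-2)(m-1)}{2}\bigr)e_{2k+3}$, $3\le m\le k+1$. $\mathfrak g_{7,\alpha}$, $\alpha\in\mathbb C$: $[e_1,e_j]=e_{j+1}$ ($2\le j\le 6$), $[e_2,e_3]=(2+\alpha)e_5$, $[e_2,e_4]=(2+\alpha)e_6$, $[e_2,e_5]=(1+\alpha)e_7$, $[e_3,e_4]=e_7$. $\mathfrak g_{8,\alpha}$, $\alpha\in\mathbb C$: the relations of $\mathfrak g_{7,\alpha}$ and $[e_1,e_7]=e_8$, $[e_2,e_6]=\alpha e_8$, $[e_3,e_5]=e_8$. $\mathfrak g_{9,\alpha}$ ($\alpha\neq-\frac52$): the relations of $\mathfrak g_{8,\alpha}$ and $[e_1,e_8]=e_9$, $[e_2,e_7]=\frac{2\alpha^2+3\alpha-2}{2\alpha+5}e_9$,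 $[e_3,e_6]=\frac{2\alpha+2}{2\alpha+5}e_9$, $[e_4,e_5]=\frac{3}{2\alpha+5}e_9$. $\mathfrak g_{10,\alpha}$ ($\alpha\neq-\frac52$): the relations of $\mathfrak g_{9,\alpha}$ and $[e_1,e_9]=e_{10}$, $[e_2,e_8]=\frac{2\alpha^2+\alpha-1}{2\alpha+5}e_{10}$, $[e_3,e_7]=\frac{2\alpha-1}{2\alpha+5}e_{10}$, $[e_4,e_6]=\frac{3}{2\alpha+5}e_{10}$. $\mathfrak g_{11,\alpha}$ ($\alpha\neq-\frac52,-1,-3$): the relations of $\mathfrak g_{10,\alpha}$ and $[e_1,e_{10}]=e_{11}$, $[e_2,e_9]=\frac{2\alpha^3+2\alpha^2+3}{2(\alpha^2+4\alpha+3)}e_{11}$, $[e_3,e_8]=\frac{4\alpha^3+8\alpha^2-8\alpha-21}{2(\alpha^2+4\alpha+3)(2\alpha+5)}e_{11}$, $[e_4,e_7]=\frac{3(2\alpha^2+4\alpha+5)}{2(\alpha^2+4\alpha+3)(2\alpha+5)}e_{11}$, $[e_5,e_6]=\frac{3(4\alpha+1)}{2(\alpha^2+4\alpha+3)(2\alpha+5)}e_{11}$. *)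

theory Defs
  imports Complex_Main
begin

locale lie_algebra = vector_space scale
  for scale :: "'k::field \<Rightarrow> 'a::ab_group_add \<Rightarrow> 'a" +
  fixes bracket :: "'a \<Rightarrow> 'a \<Rightarrow> 'a"
  assumes bracket_linear_left: "Vector_Spaces.linear scale scale (\<lambda>x. bracket x y)"
    and bracket_linear_right: "Vector_Spaces.linear scale scale (\<lambda>y. bracket x y)"
    and bracket_self: "bracket x x = 0"
    and jacobi: "bracket x (bracket y z) + bracket y (bracket z x) + bracket z (bracket x y) = 0"
begin

definition automorphism :: "('a \<Rightarrow> 'a) \<Rightarrow> bool" where
  "automorphism \<phi> \<longleftrightarrow>
     Vector_Spaces.linear scale scale \<phi> \<and> bij \<phi> \<and>
     (\<forall>x y. \<phi> (bracket x y) = bracket (\<phi> x) (\<phi> y))"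

definition two_local_automorphism :: "('a \<Rightarrow> 'a) \<Rightarrow> bool" where
  "two_local_automorphism \<Delta> \<longleftrightarrow>
     (\<forall>x y. \<exists>\<phi>. automorphism \<phi> \<and> \<Delta> x = \<phi> x \<and> \<Delta> y = \<phi> y)"

text \<open>The family \<open>e 1, \<dots>, e n\<close> is a basis of the whole space and the multiplication
  table is \<open>[e i, e j] = c i j e (i + j)\<close> for \<open>i < j\<close>; the remaining brackets of basis
  vectors are determined by skew-symmetry.  Every algebra below is graded in this way,
  so a table is given by its coefficients alone.  The value of \<open>e (i + j)\<close> for
  \<open>i + j > n\<close> is irrelevant, and \<open>c i j\<close> is never read for \<open>i \<ge> j\<close>.\<close>

definition has_table :: "nat \<Rightarrow> (nat \<Rightarrow> 'a) \<Rightarrow> (nat \<Rightarrow> nat \<Rightarrow> 'k) \<Rightarrow> bool" where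
  "has_table n e c \<longleftrightarrow>
     inj_on e {1..n} \<and> independent (e ` {1..n}) \<and> span (e ` {1..n}) = UNIV \<and>
     (\<forall>i j. 1 \<le> i \<and> i < j \<and> j \<le> n \<longrightarrow>
        bracket (e i) (e j) = (if i + j \<le> n then scale (c i j) (e (i + j)) else 0))"

end

definition m0 :: "nat \<Rightarrow> nat \<Rightarrow> nat \<Rightarrow> complex" where
  "m0 n i j = (if i = 1 \<and> 2 \<le> j \<and> j \<le> n - 1 then 1 else 0)"

definition m2 :: "nat \<Rightarrow> nat \<Rightarrow> nat \<Rightarrow> complex" where
  "m2 n i j =
    (if i = 1 \<and> 2 \<le> j \<and> j \<le> n - 1 then 1
     else if i = 2 \<and> 3 \<le> j \<and> j \<le> n - 2 then 1
     else 0)"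

definition W_plus :: "nat \<Rightarrow> nat \<Rightarrow> nat \<Rightarrow> complex" where
  "W_plus n i j = (if i + j \<le> n then of_nat j - of_nat i else 0)"

definition m01 :: "nat \<Rightarrow> nat \<Rightarrow> nat \<Rightarrow> complex" where
  "m01 k i j =
    (if i = 1 \<and> 2 \<le> j \<and> j \<le> 2 * k then 1
     else if 2 \<le> i \<and> i \<le> k \<and> j = 2 * k - i + 1 then (-1) ^ (i + 1)
     else 0)"

definition m02 :: "nat \<Rightarrow> nat \<Rightarrow> nat \<Rightarrow> complex" where
  "m02 k i j =
    (if i = 1 \<and> 2 \<le> j \<and> j \<le> 2 * k + 1 then 1
     else if 2 \<le> i \<and> i \<le> k \<and> j = 2 * k - i + 1 then (-1) ^ (i + 1)
     else if 2 \<le> i \<and> i \<le> k \<and> j = 2 * k - i + 2 then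
       (-1) ^ (i + 1) * (of_nat k - of_nat i + 1)
     else 0)"

definition m03 :: "nat \<Rightarrow> nat \<Rightarrow> nat \<Rightarrow> complex" where
  "m03 k i j =
    (if i = 1 \<and> 2 \<le> j \<and> j \<le> 2 * k + 2 then 1
     else if 2 \<le> i \<and> i \<le> k \<and> j = 2 * k - i + 1 then (-1) ^ (i + 1)
     else if 2 \<le> i \<and> i \<le> k \<and> j = 2 * k - i + 2 then
       (-1) ^ (i + 1) * (of_nat k - of_nat i + 1)
     else if 3 \<le> i \<and> i \<le> k + 1 \<and> j = 2 * k - i + 3 then
       (-1) ^ i * ((of_nat i - 2) * of_nat k - (of_nat i - 2) * (of_nat i - 1) / 2)
     else 0)"

definition g7 :: "complex \<Rightarrow> nat \<Rightarrow> nat \<Rightarrow> complex" where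
  "g7 \<alpha> i j =
    (if i = 1 \<and> 2 \<le> j \<and> j \<le> 6 then 1
     else if (i, j) = (2, 3) then 2 + \<alpha>
     else if (i, j) = (2, 4) then 2 + \<alpha>
     else if (i, j) = (2, 5) then 1 + \<alpha>
     else if (i, j) = (3, 4) then 1
     else 0)"

definition g8 :: "complex \<Rightarrow> nat \<Rightarrow> nat \<Rightarrow> complex" where
  "g8 \<alpha> i j =
    (if (i, j) = (1, 7) then 1
     else if (i, j) = (2, 6) then \<alpha>
     else if (i, j) = (3, 5) then 1
     else g7 \<alpha> i j)"

definition g9 :: "complex \<Rightarrow> nat \<Rightarrow> nat \<Rightarrow> complex" where
  "g9 \<alpha> i j =
    (if (i, j) = (1, 8) then 1
     else if (i, j) = (2, 7) then (2 * \<alpha>^2 + 3 * \<alpha> - 2) / (2 * \<alpha> + 5)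
     else if (i, j) = (3, 6) then (2 * \<alpha> + 2) / (2 * \<alpha> + 5)
     else if (i, j) = (4, 5) then 3 / (2 * \<alpha> + 5)
     else g8 \<alpha> i j)"

definition g10 :: "complex \<Rightarrow> nat \<Rightarrow> nat \<Rightarrow> complex" where
  "g10 \<alpha> i j =
    (if (i, j) = (1, 9) then 1
     else if (i, j) = (2, 8) then (2 * \<alpha>^2 + \<alpha> - 1) / (2 * \<alpha> + 5)
     else if (i, j) = (3, 7) then (2 * \<alpha> - 1) / (2 * \<alpha> + 5)
     else if (i, j) = (4, 6) then 3 / (2 * \<alpha> + 5)
     else g9 \<alpha> i j)"

definition g11 :: "complex \<Rightarrow> nat \<Rightarrow> nat \<Rightarrow> complex" where
  "g11 \<alpha> i j =
    (if (i, j) = (1, 10) then 1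
     else if (i, j) = (2, 9) then
       (2 * \<alpha>^3 + 2 * \<alpha>^2 + 3) / (2 * (\<alpha>^2 + 4 * \<alpha> + 3))
     else if (i, j) = (3, 8) then
       (4 * \<alpha>^3 + 8 * \<alpha>^2 - 8 * \<alpha> - 21) / (2 * (\<alpha>^2 + 4 * \<alpha> + 3) * (2 * \<alpha> + 5))
     else if (i, j) = (4, 7) then
       3 * (2 * \<alpha>^2 + 4 * \<alpha> + 5) / (2 * (\<alpha>^2 + 4 * \<alpha> + 3) * (2 * \<alpha> + 5))
     else if (i, j) = (5, 6) then
       3 * (4 * \<alpha> + 1) / (2 * (\<alpha>^2 + 4 * \<alpha> + 3) * (2 * \<alpha> + 5))
     else g10 \<alpha> i j)"

end

theory Submission
  imports Defs
begin

text \<open>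
  If \<open>f\<close> is a linear functional vanishing on all brackets and \<open>z\<close> is a central element with
  \<open>f z = 0\<close>, then \<open>x \<mapsto> x + f x \<cdot> z\<close> is an automorphism.  In a graded table \<open>z = e n\<close> is central and
  the first two coordinates \<open>f\<close>, \<open>g\<close> vanish on brackets, whatever the coefficients \<open>c i j\<close> are.
  The map \<open>x \<mapsto> x + h (f x, g x) \<cdot> z\<close>, where \<open>h (s, t)\<close> is \<open>s\<close> for \<open>t = 0\<close> and \<open>0\<close> otherwise, is not
  additive.  But any two values of \<open>h\<close> are interpolated by a linear form, and so the map agrees
  at any two points with one of these automorphisms.
\<close>

lemmas linear_apply_add = module_hom.add[OF module_hom_linearI]
  and linear_apply_scale = module_hom.scale[OF module_hom_linearI]
  and linear_apply_zero = module_hom.zero[OF module_hom_linearI]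
  and linear_apply_neg = module_hom.neg[OF module_hom_linearI]
  and linear_apply_diff = module_hom.diff[OF module_hom_linearI]

context lie_algebra
begin

abbreviation functional :: "('a \<Rightarrow> 'k) \<Rightarrow> bool" where
  "functional f \<equiv> Vector_Spaces.linear scale (*) f"

lemmas bracket_add_left = linear_apply_add[OF bracket_linear_left]
  and bracket_add_right = linear_apply_add[OF bracket_linear_right]
  and bracket_scale_left = linear_apply_scale[OF bracket_linear_left]
  and bracket_scale_right = linear_apply_scale[OF bracket_linear_right]
  and bracket_zero_left = linear_apply_zero[OF bracket_linear_left]
  and bracket_zero_right = linear_apply_zero[OF bracket_linear_right]

lemma bracket_antisym: "bracket x y = - bracket y x"
proof -
  have "bracket x y + bracket y x = bracket (x + y) (x + y)"
    by (simp add: bracket_add_left bracket_add_right bracket_self[of x] bracket_self[of y])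
  also have "\<dots> = 0"
    by (rule bracket_self)
  finally show ?thesis
    by (simp add: eq_neg_iff_add_eq_0)
qed

lemma functional_combination:
  assumes "functional f" "functional g"
  shows "functional (\<lambda>x. r * f x + s * g x)"
  using assms by (auto simp: Vector_Spaces.linear_iff algebra_simps)

lemma functional_bracket_eq_0:
  assumes f: "functional f" and B: "span B = UNIV"
    and zero: "\<And>x y. \<lbrakk>x \<in> B; y \<in> B\<rbrakk> \<Longrightarrow> f (bracket x y) = 0"
  shows "f (bracket x y) = 0"
proof -
  note f_simps = linear_apply_add[OF f] linear_apply_scale[OF f] linear_apply_zero[OF f]
  \<comment> \<open>Span induction frees one argument at a time: first the left one, with
    \<open>y\<close> still in \<open>B\<close>, then the right one.\<close>
  have left: "f (bracket x y) = 0" if "y \<in> B" for x y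
  proof -
    have "x \<in> span B" using B by simp
    then show ?thesis
      by (rule span_induct)
        (auto simp: subspace_def bracket_add_left bracket_scale_left bracket_zero_left
          f_simps zero that)
  qed
  have "y \<in> span B" using B by simp
  then show ?thesis
    by (rule span_induct)
      (auto simp: subspace_def bracket_add_right bracket_scale_right bracket_zero_right
        f_simps left)
qed

lemma bracket_span_eq_0:
  assumes B: "span B = UNIV" and zero: "\<And>x. x \<in> B \<Longrightarrow> bracket x z = 0"
  shows "bracket x z = 0"
proof -
  have "x \<in> span B" using B by simp
  then show ?thesis
    by (rule span_induct)
      (auto simp: subspace_def bracket_add_left bracket_scale_left bracket_zero_left zero)
qed

text \<open>Both sides of the homomorphism law reduce to \<open>bracket x y\<close>: on the left
  because \<open>f\<close> kills brackets, on the right because \<open>z\<close> is central. As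
  \<open>f z = 0\<close>, the map preserves \<open>f\<close>, so subtracting
  \<open>scale (f x) z\<close> inverts it.\<close>

lemma automorphism_add_central:
  assumes f: "functional f"
    and f_bracket: "\<And>x y. f (bracket x y) = 0"
    and central: "\<And>x. bracket x z = 0"
    and fz: "f z = 0"
  shows "automorphism (\<lambda>x. x + scale (f x) z)"
  unfolding automorphism_def
proof (intro conjI allI)
  note f_simps = linear_apply_add[OF f] linear_apply_scale[OF f]
  show "Vector_Spaces.linear scale scale (\<lambda>x. x + scale (f x) z)"
    unfolding Vector_Spaces.linear_iff
    using vector_space_axioms by (simp add: f_simps algebra_simps)
  show "bij (\<lambda>x. x + scale (f x) z)"
    by (rule o_bij[where g = "\<lambda>x. x - scale (f x) z"]) (auto simp: f_simps linear_apply_diff[OF f] fz)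
  fix x y
  have "bracket z x = 0" for x
    using central[of x] bracket_antisym[of z x] by simp
  then show "bracket x y + scale (f (bracket x y)) z
      = bracket (x + scale (f x) z) (y + scale (f y) z)"
    by (simp add: f_bracket central bracket_add_left bracket_add_right
        bracket_scale_left bracket_scale_right)
qed

lemma ex_two_local_not_automorphism:
  assumes f: "functional f" and g: "functional g"
    and f_bracket: "\<And>x y. f (bracket x y) = 0"
    and g_bracket: "\<And>x y. g (bracket x y) = 0"
    and central: "\<And>x. bracket x z = 0"
    and z: "z \<noteq> 0" "f z = 0" "g z = 0"
    and a: "f a \<noteq> 0" "g a = 0"
    and b: "g b \<noteq> 0"
  shows "\<exists>\<Delta>. two_local_automorphism \<Delta> \<and> \<not> automorphism \<Delta>"
proof (intro exI conjI)
  define h where "h = (\<lambda>x. if g x = 0 then f x else 0)"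
  define \<Delta> where "\<Delta> = (\<lambda>x. x + scale (h x) z)"
  show "two_local_automorphism \<Delta>"
    unfolding two_local_automorphism_def
  proof (intro allI)
    fix x y
    \<comment> \<open>At a point with \<open>g = 0\<close> the choice \<open>r = 1\<close> gives
      \<open>h = f\<close>. If \<open>g\<close> is nonzero at just one of the points,
      \<open>s\<close> is chosen to cancel \<open>f\<close> there; if at both, \<open>h\<close>
      vanishes at both and the zero form serves.\<close>
    obtain r s where rs: "h x = r * f x + s * g x" "h y = r * f y + s * g y"
    proof -
      consider "g x = 0" "g y = 0" | "g x = 0" "g y \<noteq> 0" | "g x \<noteq> 0" "g y = 0"
        | "g x \<noteq> 0" "g y \<noteq> 0" by blast
      then show thesis
      proof cases
        case 1 then show ?thesis using that[of 1 0] by (simp add: h_def)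
      next
        case 2 then show ?thesis using that[of 1 "- f y / g y"] by (simp add: h_def)
      next
        case 3 then show ?thesis using that[of 1 "- f x / g x"] by (simp add: h_def)
      next
        case 4 then show ?thesis using that[of 0 0] by (simp add: h_def)
      qed
    qed
    have "automorphism (\<lambda>x. x + scale (r * f x + s * g x) z)"
      by (rule automorphism_add_central)
        (simp_all add: functional_combination f g f_bracket g_bracket central z)
    then show "\<exists>\<phi>. automorphism \<phi> \<and> \<Delta> x = \<phi> x \<and> \<Delta> y = \<phi> y"
      by (intro exI[of _ "\<lambda>x. x + scale (r * f x + s * g x) z"]) (simp add: \<Delta>_def rs)
  qed
  show "\<not> automorphism \<Delta>"
  proof
    assume "automorphism \<Delta>"
    \<comment> \<open>Since \<open>g (a + b) = g b\<close> is nonzero, \<open>h\<close> vanishes at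
      \<open>b\<close> and \<open>a + b\<close> but equals \<open>f a\<close> at \<open>a\<close>;
      additivity would leave \<open>scale (f a) z = 0\<close>.\<close>
    then have "\<Delta> (a + b) = \<Delta> a + \<Delta> b"
      unfolding automorphism_def by (blast intro: linear_apply_add)
    then have "scale (f a) z = 0"
      using a b by (simp add: \<Delta>_def h_def linear_apply_add[OF g] algebra_simps)
    with a z show False by simp
  qed
qed

text \<open>Only the grading matters. The bound \<open>n \<ge> 3\<close> separates the central
  vector \<open>e n\<close> from \<open>e 1\<close> and \<open>e 2\<close>, so the first two
  coordinates vanish on it.\<close>

theorem has_table_ex_two_local_not_automorphism:
  assumes table: "has_table n e c" and n: "n \<ge> 3"
  shows "\<exists>\<Delta>. two_local_automorphism \<Delta> \<and> \<not> automorphism \<Delta>"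
proof -
  define B where "B = e ` {1..n}"
  define coord where "coord = (\<lambda>i x. representation B x (e i))"
  from table have inj: "inj_on e {1..n}" and ind: "independent B" and span: "span B = UNIV"
    and br: "\<And>i j. \<lbrakk>1 \<le> i; i < j; j \<le> n\<rbrakk> \<Longrightarrow>
      bracket (e i) (e j) = (if i + j \<le> n then scale (c i j) (e (i + j)) else 0)"
    by (auto simp: has_table_def B_def)
  have functional: "functional (coord i)" for i
    unfolding coord_def by (rule linear_representation[OF ind span])
  have coord_e: "coord i (e j) = (if i = j then 1 else 0)" if "i \<in> {1..n}" "j \<in> {1..n}" for i j
  proof -
    have "e j \<in> B" using that by (auto simp: B_def)
    then show ?thesis
      using inj_on_eq_iff[OF inj that] by (auto simp: coord_def representation_basis[OF ind])
  qed
  have coord_zero: "coord i 0 = 0" for i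
    by (rule linear_apply_zero[OF functional])
  \<comment> \<open>For \<open>p < q\<close> the degree \<open>p + q\<close> is at least 3, so the
    bracket has no component along \<open>e 1\<close> or \<open>e 2\<close>.\<close>
  have coord_less: "coord i (bracket (e p) (e q)) = 0"
    if "i \<in> {1, 2}" "1 \<le> p" "p < q" "q \<le> n" for i p q
    using that n
    by (auto simp: br coord_zero coord_e linear_apply_scale[OF functional])
  have coord_bracket: "coord i (bracket x y) = 0" if i: "i \<in> {1, 2}" for i x y
  proof (rule functional_bracket_eq_0[OF functional span])
    fix x y assume "x \<in> B" "y \<in> B"
    then obtain p q where pq: "x = e p" "y = e q" "p \<in> {1..n}" "q \<in> {1..n}"
      by (auto simp: B_def)
    \<comment> \<open>The table covers \<open>p < q\<close> alone; the other cases follow from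
      \<open>bracket_self\<close> and skew-symmetry.\<close>
    consider "p < q" | "p = q" | "q < p" by linarith
    then show "coord i (bracket x y) = 0"
    proof cases
      case 1 then show ?thesis using coord_less[OF i] pq by simp
    next
      case 2 then show ?thesis using pq by (simp add: bracket_self coord_zero)
    next
      case 3
      have "coord i (bracket x y) = - coord i (bracket y x)"
        by (subst bracket_antisym) (rule linear_apply_neg[OF functional])
      then show ?thesis using 3 coord_less[OF i] pq by simp
    qed
  qed
  \<comment> \<open>For \<open>p < n\<close> the degree \<open>p + n\<close> exceeds
    \<open>n\<close>, so the table entry is 0.\<close>
  have "bracket x (e n) = 0" if "x \<in> B" for x
  proof -
    from that obtain p where "x = e p" "p \<in> {1..n}" by (auto simp: B_def)
    then show ?thesis using br[of p n] by (cases "p = n") (auto simp: bracket_self)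
  qed
  then have central: "bracket x (e n) = 0" for x
    by (rule bracket_span_eq_0[OF span])
  have "e n \<noteq> 0"
    using coord_e[of n n] coord_zero[of n] n by auto
  \<comment> \<open>Here \<open>f\<close> and \<open>g\<close> are the first and second coordinates,
    with \<open>a = e 1\<close> and \<open>b = e 2\<close> as their dual vectors.\<close>
  then show ?thesis
    using n by (intro ex_two_local_not_automorphism[OF functional functional, of 1 2 "e n" "e 1" "e 2"])
      (simp_all add: coord_bracket central coord_e)
qed

end

theorem theorem29:
  fixes scale :: "complex \<Rightarrow> 'a::ab_group_add \<Rightarrow> 'a"
    and bracket :: "'a \<Rightarrow> 'a \<Rightarrow> 'a"
    and n :: nat and e :: "nat \<Rightarrow> 'a" and c :: "nat \<Rightarrow> nat \<Rightarrow> complex"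
  assumes lie: "lie_algebra scale bracket"
    and table: "lie_algebra.has_table scale bracket n e c"
    and listed:
      "(n \<ge> 3 \<and> c = m0 n) \<or>
       (n \<ge> 5 \<and> c = m2 n) \<or>
       (n \<ge> 12 \<and> c = W_plus n) \<or>
       (\<exists>k\<ge>3. n = 2 * k + 1 \<and> c = m01 k) \<or>
       (\<exists>k\<ge>3. n = 2 * k + 2 \<and> c = m02 k) \<or>
       (\<exists>k\<ge>3. n = 2 * k + 3 \<and> c = m03 k) \<or>
       (\<exists>\<alpha>. n = 7 \<and> c = g7 \<alpha>) \<or>
       (\<exists>\<alpha>. n = 8 \<and> c = g8 \<alpha>) \<or>
       (\<exists>\<alpha>. \<alpha> \<noteq> - 5 / 2 \<and> n = 9 \<and> c = g9 \<alpha>) \<or>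
       (\<exists>\<alpha>. \<alpha> \<noteq> - 5 / 2 \<and> n = 10 \<and> c = g10 \<alpha>) \<or>
       (\<exists>\<alpha>. \<alpha> \<noteq> - 5 / 2 \<and> \<alpha> \<noteq> - 1 \<and> \<alpha> \<noteq> - 3 \<and> n = 11 \<and> c = g11 \<alpha>)"
  shows "\<exists>\<Delta> :: 'a \<Rightarrow> 'a.
           lie_algebra.two_local_automorphism scale bracket \<Delta> \<and>
           \<not> lie_algebra.automorphism scale bracket \<Delta>"
proof -
  interpret lie_algebra scale bracket by (rule lie)
  have "n \<ge> 3" using listed by auto
  then show ?thesis
    by (rule has_table_ex_two_local_not_automorphism[OF table])
qed

end
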